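(* Let $\hat\Sigma_{\rm BS}^2(\tau)=\sum_{n=0}^\infty a_n\tau^n$ be the power series expansion around $\tau=0$ of the function $\hat\Sigma_{\rm BS}^2$ defined in the context. This series converges for all complex $\tau$ with $|\tau|\le R_\tau$, where $R_\tau=\frac{y_0}{\cosh y_0}\simeq0.662743$ and $y_0\simeq1.19968$ is the positive solution of the equation $y\tanh y=1$.
   Context: The function $\hat\Sigma_{\rm BS}^2$ is defined near $\tau=0$ by $$\hat\Sigma_{\rm BS}^2(\tau)=\frac{\sin2\lambda}{\lambda}-\frac12(1+\cos(2\lambda)),\qquad\lambda=\lambda(\tau),$$ where $\lambda(\tau)$ is the analytic local inverse, with $\lambda(0)=0$, of the map $\lambda\mapsto\tau=\frac{\lambda}{\cos\lambda}$, and $\frac{\sin 2\lambda}{\lambda}$ is understood as $2$ at $\lambda=0$. *)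

theory Defs
  imports "HOL-Complex_Analysis.Complex_Analysis"
begin

definition analytic_local_inverse :: "(complex \<Rightarrow> complex) \<Rightarrow> (complex \<Rightarrow> complex) \<Rightarrow> complex \<Rightarrow> bool"
  where "analytic_local_inverse g f z \<longleftrightarrow>
    g analytic_on {f z} \<and> g (f z) = z \<and>
    (\<forall>\<^sub>F w in nhds (f z). f (g w) = w) \<and> (\<forall>\<^sub>F u in nhds z. g (f u) = u)"

definition tau_of :: "complex \<Rightarrow> complex"
  where "tau_of l = l / cos l"

definition Sigma_BS_of :: "complex \<Rightarrow> complex"
  where "Sigma_BS_of l = (if l = 0 then 2 else sin (2 * l) / l) - 1 / 2 * (1 + cos (2 * l))"

text \<open>
  The local inverse is only determined as a germ at \<open>0\<close>, so it is passed as a parameter; only the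
  behaviour of the resulting function near \<open>0\<close> is meaningful.
\<close>

definition hat_Sigma_BS :: "(complex \<Rightarrow> complex) \<Rightarrow> complex \<Rightarrow> complex"
  where "hat_Sigma_BS lam \<tau> = Sigma_BS_of (lam \<tau>)"

definition y0 :: real
  where "y0 = (THE y. 0 < y \<and> y * tanh y = 1)"

definition R_tau :: real
  where "R_tau = y0 / cosh y0"

text \<open>
  The following facts show that the local inverse and the power series expansion exist.
\<close>

lemma ex_analytic_local_inverse_tau_of: "\<exists>lam. analytic_local_inverse lam tau_of 0"
proof -
  have "open (- {z. cos z = (0::complex)})"
    by (intro open_Compl closed_Collect_eq continuous_intros)
  then obtain d where d: "d > 0" "ball 0 d \<subseteq> - {z. cos z = (0::complex)}"
    by (metis (mono_tags, lifting) ComplI cos_zero mem_Collect_eq openE zero_neq_one)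
  have hol: "tau_of holomorphic_on ball 0 d"
    unfolding tau_of_def using d by (intro holomorphic_intros) auto
  have "(tau_of has_field_derivative 1) (at 0)"
    unfolding tau_of_def by (auto intro!: derivative_eq_intros)
  hence dnz: "deriv tau_of 0 \<noteq> 0"
    by (simp add: DERIV_imp_deriv)
  have zero_in: "0 \<in> ball (0::complex) d"
    using d(1) by simp
  obtain r where r: "r > 0" "ball 0 r \<subseteq> ball (0::complex) d" "inj_on tau_of (ball 0 r)"
    by (rule has_complex_derivative_locally_injective[OF hol zero_in open_ball dnz]) (rule that)
  have hol': "tau_of holomorphic_on ball 0 r"
    using hol r(2) holomorphic_on_subset by blast
  obtain g where g: "g holomorphic_on (tau_of ` ball 0 r)" "\<And>z. z \<in> ball 0 r \<Longrightarrow> g (tau_of z) = z"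
    by (rule holomorphic_has_inverse[OF hol' open_ball r(3)]) (rule that)
  have op: "open (tau_of ` ball 0 r)"
    by (rule open_mapping_thm3[OF hol' open_ball r(3)])
  have mem: "tau_of 0 \<in> tau_of ` ball 0 r"
    using r(1) by simp
  have "g analytic_on {tau_of 0}"
    using g(1) op mem analytic_at by blast
  moreover have "\<forall>\<^sub>F w in nhds (tau_of 0). tau_of (g w) = w"
    unfolding eventually_nhds
  proof (intro exI[of _ "tau_of ` ball 0 r"] conjI ballI op mem)
    fix w assume "w \<in> tau_of ` ball 0 r"
    then obtain z where "z \<in> ball 0 r" "w = tau_of z" by blast
    with g(2) show "tau_of (g w) = w" by metis
  qed
  moreover have "\<forall>\<^sub>F u in nhds 0. g (tau_of u) = u"
    unfolding eventually_nhds
  proof (intro exI[of _ "ball 0 r"] conjI ballI)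
    show "g (tau_of u) = u" if "u \<in> ball 0 r" for u
      by (rule g(2)[OF that])
  qed (use r(1) in simp_all)
  moreover have "g (tau_of 0) = 0"
    by (rule g(2)) (use r(1) in simp)
  ultimately show ?thesis
    unfolding analytic_local_inverse_def by blast
qed

lemma Sigma_BS_of_analytic_at_0: "Sigma_BS_of analytic_on {0}"
proof -
  have "((\<lambda>z::complex. sin (2 * z)) has_field_derivative 2) (at 0)"
    by (auto intro!: derivative_eq_intros)
  hence "(\<lambda>z::complex. sin (2 * z) / z) \<midarrow>0\<rightarrow> 2"
    by (simp add: has_field_derivative_iff)
  hence lim: "(\<lambda>z::complex. if z = 0 then 2 else sin (2 * z) / z) \<midarrow>0\<rightarrow> 2"
    by (rule Lim_transform_eventually) (simp add: eventually_at_filter)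
  have hol: "(\<lambda>z::complex. if z = 0 then 2 else sin (2 * z) / z) holomorphic_on (UNIV - {0})"
    by (rule holomorphic_transform[of "\<lambda>z. sin (2 * z) / z"]) (intro holomorphic_intros, auto)
  have "(\<lambda>z::complex. if z = 0 then 2 else sin (2 * z) / z) holomorphic_on UNIV"
  proof (rule no_isolated_singularity[OF _ hol])
    show "continuous_on UNIV (\<lambda>z::complex. if z = 0 then 2 else sin (2 * z) / z)"
      unfolding continuous_on_eq_continuous_at[OF open_UNIV]
    proof
      fix x :: complex
      show "isCont (\<lambda>z. if z = 0 then 2 else sin (2 * z) / z) x"
      proof (cases "x = 0")
        case True
        then show ?thesis using lim by (simp add: isCont_def)
      next
        case False
        then show ?thesis
          using holomorphic_on_imp_continuous_on[OF hol]
          by (auto simp: continuous_on_eq_continuous_at open_Diff)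
      qed
    qed
  qed auto
  hence "Sigma_BS_of holomorphic_on UNIV"
    unfolding Sigma_BS_of_def by (intro holomorphic_intros)
  thus ?thesis
    using analytic_at by blast
qed

lemma hat_Sigma_BS_has_fps_expansion:
  assumes "analytic_local_inverse lam tau_of 0"
  shows   "hat_Sigma_BS lam has_fps_expansion fps_expansion (hat_Sigma_BS lam) 0"
proof (rule analytic_at_imp_has_fps_expansion_0)
  have "lam analytic_on {0}" "lam 0 = 0"
    using assms by (auto simp: analytic_local_inverse_def tau_of_def)
  hence "(Sigma_BS_of \<circ> lam) analytic_on {0}"
    using Sigma_BS_of_analytic_at_0 by (intro analytic_on_compose) auto
  thus "hat_Sigma_BS lam analytic_on {0}"
    by (simp add: o_def hat_Sigma_BS_def[abs_def])
qed

end

theory Submission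
  imports Defs
begin

text \<open>
  The local inverse \<open>L\<close> satisfies \<open>L = X \<cdot> (cos \<circ> L)\<close> as a power series. Let \<open>P\<^sub>n\<close> be the sum of
  \<open>\<bar>L\<^sub>k\<bar> R\<^sup>k\<close> over \<open>k \<le> n\<close>. Replacing all coefficients by their absolute values
  gives \<open>P\<^sub>n\<^sub>+\<^sub>1 \<le> R cosh P\<^sub>n\<close>. As \<open>R cosh y\<^sub>0 = y\<^sub>0\<close> and \<open>cosh\<close> is monotone, \<open>P\<^sub>n \<le> y\<^sub>0\<close> for all \<open>n\<close>.
  So \<open>L\<close> converges absolutely on the closed disc, and composing with an entire function preserves this.
\<close>

section \<open>Truncated majorants of power series\<close>

text \<open>Truncating at \<open>n\<close> keeps every estimate a finite sum, so convergence need
  not be known in advance.\<close>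

definition majorant_sum :: "real \<Rightarrow> nat \<Rightarrow> 'a::real_normed_field fps \<Rightarrow> real"
  where "majorant_sum r n f = (\<Sum>k\<le>n. norm (fps_nth f k) * r ^ k)"

lemma majorant_sum_nonneg: "r \<ge> 0 \<Longrightarrow> majorant_sum r n f \<ge> 0"
  unfolding majorant_sum_def by (intro sum_nonneg mult_nonneg_nonneg) auto

text \<open>By the triangle inequality, the truncated Cauchy product is bounded by a sum over the
  triangle \<open>i + j \<le> n\<close>. That triangle lies in the square on which the right-hand
  product expands, and the extra terms are nonnegative.\<close>

lemma majorant_sum_mult_le:
  assumes r: "r \<ge> 0"
  shows   "majorant_sum r n (f * g) \<le> majorant_sum r n f * majorant_sum r n g"
proof -
  define h where "h i j = norm (fps_nth f i) * r ^ i * (norm (fps_nth g j) * r ^ j)" for i j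
  have h_nonneg: "h i j \<ge> 0" for i j
    using r by (simp add: h_def)
  have "majorant_sum r n (f * g) \<le> (\<Sum>k\<le>n. \<Sum>i\<le>k. h i (k - i))"
    unfolding majorant_sum_def
  proof (intro sum_mono)
    fix k
    have "norm (fps_nth (f * g) k) * r ^ k
        \<le> (\<Sum>i\<le>k. norm (fps_nth f i * fps_nth g (k - i))) * r ^ k"
      unfolding fps_mult_nth atLeast0AtMost using r
      by (intro mult_right_mono norm_sum) auto
    also have "\<dots> = (\<Sum>i\<le>k. h i (k - i))"
      unfolding sum_distrib_right h_def
      by (intro sum.cong refl) (simp add: norm_mult flip: power_add)
    finally show "norm (fps_nth (f * g) k) * r ^ k \<le> (\<Sum>i\<le>k. h i (k - i))" .
  qed
  also have "\<dots> = (\<Sum>(i,j)\<in>{(i,j). i + j \<le> n}. h i j)"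
    by (rule sum.triangle_reindex_eq [symmetric])
  also have "\<dots> \<le> (\<Sum>(i,j)\<in>{..n} \<times> {..n}. h i j)"
    using h_nonneg by (intro sum_mono2) auto
  also have "\<dots> = majorant_sum r n f * majorant_sum r n g"
    by (simp add: majorant_sum_def h_def sum_product flip: sum.cartesian_product)
  finally show ?thesis .
qed

lemma majorant_sum_power_le:
  assumes "r \<ge> 0"
  shows   "majorant_sum r n (f ^ i) \<le> majorant_sum r n f ^ i"
proof (induction i)
  case 0
  show ?case
    by (simp add: majorant_sum_def if_distrib if_distribR cong: if_cong)
next
  case (Suc i)
  have "majorant_sum r n (f ^ Suc i) \<le> majorant_sum r n f * majorant_sum r n (f ^ i)"
    using majorant_sum_mult_le[OF assms] by simp
  also have "\<dots> \<le> majorant_sum r n f * majorant_sum r n f ^ i"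
    by (intro mult_left_mono Suc.IH majorant_sum_nonneg assms)
  finally show ?case by simp
qed

text \<open>The sequence \<open>b\<close> stands for any convergent majorant of the outer series at
  \<open>p\<close>: the \<open>cosh\<close> series when \<open>h\<close> is the cosine, and the
  terms themselves when \<open>h\<close> is the expansion of \<open>Sigma_BS_of\<close>.\<close>

lemma majorant_sum_compose_le:
  assumes r: "r \<ge> 0"
    and L: "majorant_sum r n L \<le> p"
    and h: "\<And>i. norm (fps_nth h i) * p ^ i \<le> b i" and b: "b sums s"
  shows   "majorant_sum r n (h oo L) \<le> s"
proof -
  have p: "p \<ge> 0"
    using majorant_sum_nonneg[OF r] L by (rule order_trans)
  have "norm (fps_nth (h oo L) k) \<le> (\<Sum>i\<le>n. norm (fps_nth h i) * norm (fps_nth (L ^ i) k))"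
    if "k \<le> n" for k
  proof -
    have "norm (fps_nth (h oo L) k) \<le> (\<Sum>i\<le>k. norm (fps_nth h i * fps_nth (L ^ i) k))"
      unfolding fps_compose_nth atLeast0AtMost by (rule norm_sum)
    \<comment> \<open>Enlarging the range of \<open>i\<close> makes it independent of
      \<open>k\<close>, so the double sum can be swapped.\<close>
    also have "\<dots> \<le> (\<Sum>i\<le>n. norm (fps_nth h i * fps_nth (L ^ i) k))"
      using that by (intro sum_mono2) auto
    finally show ?thesis by (simp add: norm_mult)
  qed
  hence "majorant_sum r n (h oo L)
      \<le> (\<Sum>k\<le>n. (\<Sum>i\<le>n. norm (fps_nth h i) * norm (fps_nth (L ^ i) k)) * r ^ k)"
    unfolding majorant_sum_def using r by (intro sum_mono mult_right_mono) auto
  also have "\<dots> = (\<Sum>i\<le>n. norm (fps_nth h i) * majorant_sum r n (L ^ i))"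
    unfolding majorant_sum_def sum_distrib_left sum_distrib_right
    by (subst sum.swap) (simp add: mult.assoc)
  also have "\<dots> \<le> (\<Sum>i\<le>n. b i)"
  proof (intro sum_mono)
    fix i
    have "majorant_sum r n (L ^ i) \<le> p ^ i"
      using majorant_sum_power_le[OF r] power_mono[OF L majorant_sum_nonneg[OF r]]
      by (rule order_trans)
    hence "norm (fps_nth h i) * majorant_sum r n (L ^ i) \<le> norm (fps_nth h i) * p ^ i"
      by (intro mult_left_mono) auto
    also note h
    finally show "norm (fps_nth h i) * majorant_sum r n (L ^ i) \<le> b i" .
  qed
  also have "\<dots> \<le> s"
  proof -
    have "0 \<le> b i" for i
      using h[of i] p by (meson mult_nonneg_nonneg norm_ge_zero order_trans zero_le_power)
    thus ?thesis
      using b by (auto simp: sums_iff intro!: sum_le_suminf)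
  qed
  finally show ?thesis .
qed

lemma majorant_sum_fixpoint_le:
  fixes L :: "complex fps"
  assumes L: "L = fps_X * (fps_cos 1 oo L)" and r: "r \<ge> 0" and p: "p \<ge> 0" "r * cosh p \<le> p"
  shows   "majorant_sum r n L \<le> p"
proof (induction n)
  have L0: "fps_nth L 0 = 0"
    by (subst L) simp
  case 0
  show ?case using p L0 by (simp add: majorant_sum_def)
next
  have L0: "fps_nth L 0 = 0" and LSuc: "fps_nth L (Suc k) = fps_nth (fps_cos 1 oo L) k" for k
    by (subst L, simp)+
  case (Suc n)
  have "norm (fps_nth (fps_cos 1 :: complex fps) i) * p ^ i
      \<le> (if even i then p ^ i /\<^sub>R fact i else 0)" for i
    by (simp add: fps_cos_def norm_divide norm_power field_simps)
  hence "majorant_sum r n (fps_cos 1 oo L) \<le> cosh p"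
    by (rule majorant_sum_compose_le[OF r Suc.IH _ cosh_converges])
  \<comment> \<open>The factor \<open>fps_X\<close> shifts indices by one: the coefficients of
    \<open>L\<close> up to \<open>Suc n\<close> need those of the composition only up to
    \<open>n\<close>, which is what drives the induction.\<close>
  moreover have "majorant_sum r (Suc n) L = r * majorant_sum r n (fps_cos 1 oo L)"
    by (simp add: majorant_sum_def sum.atMost_Suc_shift L0 LSuc sum_distrib_left mult_ac
             del: sum.atMost_Suc)
  ultimately show ?case
    using p(2) r by (metis mult_left_mono order_trans)
qed

text \<open>The bound holds at \<open>r\<close> itself and not just below it, so the boundary circle
  is included.\<close>

lemma summable_if_majorant_sum_bounded:
  fixes f :: "'a::{real_normed_field,banach} fps"
  assumes "\<And>n. majorant_sum r n f \<le> B" and z: "norm z \<le> r"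
  shows   "summable (\<lambda>n. fps_nth f n * z ^ n)"
proof (rule summable_comparison_test')
  have "r \<ge> 0" using norm_ge_zero z by (rule order_trans)
  thus "summable (\<lambda>n. norm (fps_nth f n) * r ^ n)"
    using assms(1) by (intro bounded_imp_summable[of _ B]) (auto simp: majorant_sum_def)
  show "norm (fps_nth f n * z ^ n) \<le> norm (fps_nth f n) * r ^ n" for n
    using z by (auto simp: norm_mult norm_power intro!: mult_left_mono power_mono)
qed

section \<open>The constants\<close>

lemma mult_tanh_strict_mono:
  assumes "0 < x" "x < (y::real)"
  shows   "x * tanh x < y * tanh y"
  using assms by (intro mult_strict_mono) auto

text \<open>For \<open>y > 1\<close> this reduces comparing \<open>y * tanh y\<close> with 1 to
  comparing \<open>exp (2 * y)\<close> with \<open>(y + 1) / (y - 1)\<close>.\<close>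

lemma mult_tanh_eq: "y * tanh y = y * (exp (2 * y) - 1) / (exp (2 * y) + (1::real))"
proof -
  have "1 - inverse (exp (2 * y)) = (exp (2 * y) - 1) / exp (2 * y)"
    and "1 + inverse (exp (2 * y)) = (exp (2 * y) + 1) / exp (2 * y)"
    by (simp_all add: field_simps)
  thus ?thesis
    by (simp add: tanh_real_altdef exp_minus)
qed

text \<open>The Lagrange remainder is at most \<open>exp x * x ^ n / fact n\<close>; moving it to
  the left gives an upper bound for \<open>exp x\<close> once the factor there is positive.\<close>

lemma exp_mult_le_Taylor:
  assumes "x \<ge> (0::real)"
  shows   "exp x * (1 - x ^ n / fact n) \<le> (\<Sum>m<n. x ^ m / fact m)"
proof -
  obtain t where t: "\<bar>t\<bar> \<le> \<bar>x\<bar>" "exp x = (\<Sum>m<n. x ^ m / fact m) + exp t / fact n * x ^ n"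
    using Maclaurin_exp_le by blast
  have "exp t / fact n * x ^ n \<le> exp x / fact n * x ^ n"
    using t(1) assms by (intro mult_right_mono divide_right_mono) auto
  moreover have "exp x * (1 - x ^ n / fact n) = exp x - exp x / fact n * x ^ n"
    by (simp add: right_diff_distrib)
  ultimately show ?thesis
    using t(2) by linarith
qed

text \<open>
  The bracket for \<open>y\<^sub>0\<close> is much tighter than the claimed one because it also has to yield the
  digits of \<open>R\<^sub>\<tau>\<close> through \<open>R\<^sub>\<tau>\<^sup>2 = y\<^sub>0\<^sup>2 - 1\<close>.
\<close>

lemma mult_tanh_lower: "1.1996783 * tanh 1.1996783 < (1::real)"
proof -
  let ?x = "2.3993566 :: real"
  have "exp ?x * (1 - ?x ^ 16 / fact 16) \<le> (\<Sum>m<16. ?x ^ m / fact m)"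
    by (rule exp_mult_le_Taylor) simp
  \<comment> \<open>The quotient is \<open>(y + 1) / (y - 1)\<close> at
    \<open>y = 1.1996783\<close>, and \<open>?x\<close> is \<open>2 * y\<close>.\<close>
  moreover have "(\<Sum>m<16. ?x ^ m / fact m) < 2.1996783 / 0.1996783 * (1 - ?x ^ 16 / fact 16)"
    by (simp add: eval_nat_numeral fact_numeral)
  ultimately have "exp ?x * (1 - ?x ^ 16 / fact 16) < 2.1996783 / 0.1996783 * (1 - ?x ^ 16 / fact 16)"
    by (rule le_less_trans)
  moreover have "1 - ?x ^ 16 / fact 16 > 0"
    by (simp add: eval_nat_numeral fact_numeral)
  ultimately have "exp ?x < 2.1996783 / 0.1996783"
    by (simp only: mult_less_cancel_right_pos)
  thus ?thesis
    unfolding mult_tanh_eq by (simp add: field_simps add_pos_pos)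
qed

lemma mult_tanh_upper: "1.19967868 * tanh 1.19967868 > (1::real)"
proof -
  let ?x = "2.39935736 :: real"
  obtain t where t: "exp ?x = (\<Sum>m<16. ?x ^ m / fact m) + exp t / fact 16 * ?x ^ 16"
    using Maclaurin_exp_le by blast
  have "2.19967868 / 0.19967868 < (\<Sum>m<16. ?x ^ m / fact m)"
    by (simp add: eval_nat_numeral fact_numeral)
  \<comment> \<open>For a lower bound the positive remainder is simply dropped.\<close>
  also have "\<dots> \<le> exp ?x"
    unfolding t by simp
  finally show ?thesis
    unfolding mult_tanh_eq by (simp add: field_simps add_pos_pos)
qed

lemma ex_mult_tanh_eq_1: "\<exists>y::real. 1.1996783 < y \<and> y < 1.19967868 \<and> y * tanh y = 1"
proof -
  have "\<exists>y\<ge>1.1996783. y \<le> 1.19967868 \<and> y * tanh y = (1::real)"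
    by (rule IVT') (use mult_tanh_lower mult_tanh_upper in \<open>auto intro!: continuous_intros\<close>)
  thus ?thesis
    using mult_tanh_lower mult_tanh_upper by (metis order_less_le order.irrefl)
qed

lemma ex1_mult_tanh_eq_1: "\<exists>!y::real. 0 < y \<and> y * tanh y = 1"
proof -
  obtain y :: real where y: "1.1996783 < y" "y * tanh y = 1"
    using ex_mult_tanh_eq_1 by blast
  show ?thesis
  proof (rule ex1I[of _ y])
    show "0 < y \<and> y * tanh y = 1" using y by simp
    show "z = y" if "0 < z \<and> z * tanh z = 1" for z
      using that y mult_tanh_strict_mono[of z y] mult_tanh_strict_mono[of y z]
      by (cases z y rule: linorder_cases) auto
  qed
qed

lemma y0_bounds: "1.1996783 < y0" "y0 < 1.19967868"
  and y0_mult_tanh: "y0 * tanh y0 = 1"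
proof -
  obtain y :: real where y: "1.1996783 < y" "y < 1.19967868" "y * tanh y = 1"
    using ex_mult_tanh_eq_1 by blast
  have "y0 = y"
    unfolding y0_def using y ex1_mult_tanh_eq_1 by (intro the1_equality) auto
  with y show "1.1996783 < y0" "y0 < 1.19967868" "y0 * tanh y0 = 1" by simp_all
qed

lemma R_tau_mult_cosh: "R_tau * cosh y0 = y0"
  by (simp add: R_tau_def)

text \<open>Squaring \<open>y0 * sinh y0 = cosh y0\<close> and eliminating \<open>sinh\<close>
  expresses \<open>cosh y0\<close> through \<open>y0\<close>, so bounding \<open>R_tau\<close> needs
  no estimate of \<open>cosh\<close>.\<close>

lemma R_tau_squared: "R_tau\<^sup>2 = y0\<^sup>2 - 1"
proof -
  have "y0 * sinh y0 = cosh y0"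
    using y0_mult_tanh by (simp add: tanh_def field_simps)
  hence "y0\<^sup>2 * ((cosh y0)\<^sup>2 - 1) = (cosh y0)\<^sup>2"
    by (metis power_mult_distrib sinh_square_eq)
  thus ?thesis
    by (simp add: R_tau_def field_simps)
qed

lemma R_tau_bounds: "0.6627425 < R_tau" "R_tau < 0.6627435"
proof -
  have "1.1996783\<^sup>2 < y0\<^sup>2" "y0\<^sup>2 < 1.19967868\<^sup>2"
    using y0_bounds by (auto intro!: power_strict_mono)
  hence "0.6627425\<^sup>2 < R_tau\<^sup>2" "R_tau\<^sup>2 < 0.6627435\<^sup>2"
    unfolding R_tau_squared by (simp_all add: power2_eq_square)
  moreover have "R_tau \<ge> 0"
    using y0_bounds by (simp add: R_tau_def)
  ultimately show "0.6627425 < R_tau" "R_tau < 0.6627435"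
    using power2_less_imp_less[of "0.6627425" R_tau] power2_less_imp_less[of R_tau "0.6627435"]
    by simp_all
qed

section \<open>The expansion of the implied variance\<close>

lemma Sigma_BS_of_entire_expansion:
  obtains S where "Sigma_BS_of has_fps_expansion S" "fps_conv_radius S = \<infinity>"
proof -
  define S :: "complex fps" where
    "S = fps_shift 1 (fps_sin 2) - fps_const (1/2) * (fps_const 1 + fps_cos 2)"
  \<comment> \<open>The exponent in \<open>l ^ 1\<close> matches the expansion rule for
    \<open>fps_shift 1\<close>; the value 2 at 0 is the linear coefficient of
    \<open>fps_sin 2\<close>.\<close>
  have "(\<lambda>l. (if l = 0 then 2 else sin (2 * l) / l ^ 1) - 1 / 2 * (1 + cos (2 * l)))
          has_fps_expansion S"
    unfolding S_def
  proof (intro fps_expansion_intros)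
    have "fps_nth (fps_sin 2 :: complex fps) 1 \<noteq> 0"
      by simp
    hence "(fps_sin 2 :: complex fps) \<noteq> 0"
      by (metis fps_zero_nth)
    thus "1 \<le> subdegree (fps_sin 2 :: complex fps)"
      by (intro subdegree_geI) auto
  qed auto
  moreover have "fps_conv_radius S \<ge> \<infinity>"
    unfolding S_def
    by (intro fps_conv_radius_diff_ge fps_conv_radius_mult_ge fps_conv_radius_add_ge) auto
  ultimately show ?thesis
    using that unfolding Sigma_BS_of_def[abs_def] power_one_right by simp
qed

lemma local_inverse_expansion:
  assumes "analytic_local_inverse lam tau_of 0"
  obtains L where "lam has_fps_expansion L" "fps_nth L 0 = 0" "L = fps_X * (fps_cos 1 oo L)"
proof -
  define L where "L = fps_expansion lam 0"
  have lam: "lam analytic_on {0}" "lam 0 = 0" "\<forall>\<^sub>F w in nhds 0. tau_of (lam w) = w"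
    using assms by (auto simp: analytic_local_inverse_def tau_of_def)
  have L: "lam has_fps_expansion L"
    unfolding L_def by (rule analytic_at_imp_has_fps_expansion_0) fact
  have L0: "fps_nth L 0 = 0"
    using has_fps_expansion_imp_0_eq_fps_nth_0[OF L] lam(2) by simp
  have "(\<lambda>w. w * (cos \<circ> lam) w) has_fps_expansion fps_X * (fps_cos 1 oo L)"
    by (intro fps_expansion_intros L L0)
  moreover have "\<forall>\<^sub>F w in nhds 0. w * (cos \<circ> lam) w = lam w"
    using lam(3)
  proof eventually_elim
    case (elim w)
    then show ?case
      \<comment> \<open>If \<open>cos (lam w) = 0\<close>, division by zero gives
        \<open>tau_of (lam w) = 0\<close>, hence \<open>w = 0\<close>. So for
        \<open>w \<noteq> 0\<close> the denominator can be cleared, and \<open>w = 0\<close> follows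
        from \<open>lam 0 = 0\<close>.\<close>
      using lam(2) by (cases "w = 0") (auto simp: tau_of_def divide_eq_eq split: if_splits)
  qed
  ultimately have "lam has_fps_expansion fps_X * (fps_cos 1 oo L)"
    using has_fps_expansion_cong[OF _ refl] by metis
  with L L0 show ?thesis
    using that fps_expansion_unique_complex by metis
qed

theorem proposition2:
  fixes lam :: "complex \<Rightarrow> complex" and a :: "nat \<Rightarrow> complex"
  assumes "analytic_local_inverse lam tau_of 0"
    and "hat_Sigma_BS lam has_fps_expansion Abs_fps a"
  shows "(\<exists>!y::real. 0 < y \<and> y * tanh y = 1) \<and>
         \<bar>y0 - 1.19968\<bar> < 0.000005 \<and>
         \<bar>R_tau - 0.662743\<bar> < 0.0000005 \<and>
         (\<forall>\<tau>::complex. cmod \<tau> \<le> R_tau \<longrightarrow> summable (\<lambda>n. a n * \<tau> ^ n))"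
proof (intro conjI allI impI)
  show "\<exists>!y::real. 0 < y \<and> y * tanh y = 1"
    by (rule ex1_mult_tanh_eq_1)
  show "\<bar>y0 - 1.19968\<bar> < 0.000005"
    using y0_bounds by (simp add: abs_less_iff)
  show "\<bar>R_tau - 0.662743\<bar> < 0.0000005"
    using R_tau_bounds unfolding abs_less_iff by simp
  fix \<tau> :: complex
  assume \<tau>: "cmod \<tau> \<le> R_tau"
  obtain S where S: "Sigma_BS_of has_fps_expansion S" "fps_conv_radius S = \<infinity>"
    by (rule Sigma_BS_of_entire_expansion)
  obtain L where L: "lam has_fps_expansion L" "fps_nth L 0 = 0" "L = fps_X * (fps_cos 1 oo L)"
    using local_inverse_expansion assms(1) by blast
  have "(Sigma_BS_of \<circ> lam) has_fps_expansion (S oo L)"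
    by (rule has_fps_expansion_compose) (use S L in auto)
  hence "hat_Sigma_BS lam has_fps_expansion (S oo L)"
    by (simp add: o_def hat_Sigma_BS_def[abs_def])
  hence a: "Abs_fps a = S oo L"
    using assms(2) fps_expansion_unique_complex by blast
  have pos: "R_tau \<ge> 0" "y0 \<ge> 0"
    using R_tau_bounds y0_bounds by auto
  have bound: "majorant_sum R_tau n L \<le> y0" for n
    using L(3) pos by (rule majorant_sum_fixpoint_le) (simp add: R_tau_mult_cosh)
  \<comment> \<open>Since \<open>S\<close> has infinite radius of convergence, it converges
    absolutely at \<open>y0\<close>, the bound for the majorant of \<open>L\<close>.\<close>
  have "summable (\<lambda>i. norm (fps_nth S i * of_real y0 ^ i))"
    by (rule norm_summable_fps) (simp add: S)
  hence "summable (\<lambda>i. norm (fps_nth S i) * y0 ^ i)"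
    using pos by (simp add: norm_mult norm_power)
  hence "majorant_sum R_tau n (S oo L) \<le> (\<Sum>i. norm (fps_nth S i) * y0 ^ i)" for n
    by (intro majorant_sum_compose_le[OF pos(1) bound order_refl] summable_sums)
  from summable_if_majorant_sum_bounded[OF this \<tau>]
  show "summable (\<lambda>n. a n * \<tau> ^ n)"
    by (simp flip: a)
qed

end
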